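(* Let $G=(V\cup E,\varepsilon)$ be a 2-connected balanced bipartite graph with $|V|=|E|=n$. If $G$ has an ear decomposition such that each ear is a path from some element of $V$ to some element of $E$, then the coefficient of $x^{n-1}$ in the interior polynomial $I_G(x)$ is $1$.
   Context: $G=(V\cup E,\varepsilon)$ denotes a finite simple bipartite graph with non-empty colour classes $V$ and $E$ and edge set $\varepsilon$; the elements of $E$ are called hyperedges. $G$ is balanced if $|V|=|E|$. An ear decomposition of $G$ starts with a cycle of $G$ (the starting cycle is not counted as an ear) and builds $G$ by successively adding ears, where an ear is a path of length at least 1 whose two distinct endpoints lie in the graph constructed so far and whose internal vertices and edges are new. For connected $G$, a hypertree of $G$ is a function $f:E\to\{0,1,2,\dots\}$ for which there is a spanning tree $\tau$ of $G$ with $d_\tau(e)=f(e)+1$ for every $e\in E$. For distinct $e,e'\in E$, we say that $e$ can transfer valence to $e'$ with respect to a hypertree $f$ if the function obtained from $f$ by decreasing $f(e)$ by 1 and increasing $f(e')$ by 1 is also a hypertree. Fix a total order on $E$. A hyperedge $e$ is internally inactive with respect to $f$ if there is $e'<e$ such that $e$ can transfer valence to $e'$ with respect to $f$; otherwise it is internally active. Let $\overline{\iota}(f)$ be the number of internally inactive hyperedges. The interior polynomial is $I_G(x)=\sum_f x^{\overline{\iota}(f)}$, the sum being over all hypertrees $f$ of $G$. It is known that $I_G$ does not depend on the order on $E$, nor on which of the two colour classes is taken as the set of hyperedges. *)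

theory Defs
  imports "HOL-Computational_Algebra.Polynomial" "HOL-Library.FuncSet"
begin

text \<open>
  A simple graph is given by its vertex set \<open>W\<close> and a set \<open>F\<close> of two-element sets of vertices.
  Walks, paths and cycles are lists of vertices; a cycle does not repeat its first vertex at the end.
\<close>

definition bipartite_graph :: "'a set \<Rightarrow> 'a set \<Rightarrow> 'a set set \<Rightarrow> bool" where
  "bipartite_graph V E \<epsilon> \<longleftrightarrow>
     finite V \<and> finite E \<and> V \<noteq> {} \<and> E \<noteq> {} \<and> V \<inter> E = {} \<and>
     \<epsilon> \<subseteq> {{v, e} | v e. v \<in> V \<and> e \<in> E}"

definition connected_graph :: "'a set \<Rightarrow> 'a set set \<Rightarrow> bool" where
  "connected_graph W F \<longleftrightarrow>
     W \<noteq> {} \<and> (\<forall>x\<in>W. \<forall>y\<in>W. (x, y) \<in> {(a, b). a \<in> W \<and> b \<in> W \<and> {a, b} \<in> F}\<^sup>*)"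

definition two_connected_graph :: "'a set \<Rightarrow> 'a set set \<Rightarrow> bool" where
  "two_connected_graph W F \<longleftrightarrow>
     card W > 2 \<and> connected_graph W F \<and>
     (\<forall>x\<in>W. connected_graph (W - {x}) {d \<in> F. x \<notin> d})"

fun walk_edges :: "'a list \<Rightarrow> 'a set set" where
  "walk_edges (x # y # p) = insert {x, y} (walk_edges (y # p))"
| "walk_edges p = {}"

definition cycle_edges :: "'a list \<Rightarrow> 'a set set" where
  "cycle_edges c = walk_edges (c @ [hd c])"

definition is_cycle :: "'a set set \<Rightarrow> 'a list \<Rightarrow> bool" where
  "is_cycle F c \<longleftrightarrow> length c \<ge> 3 \<and> distinct c \<and> cycle_edges c \<subseteq> F"

definition spanning_tree :: "'a set \<Rightarrow> 'a set set \<Rightarrow> 'a set set \<Rightarrow> bool" where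
  "spanning_tree W F T \<longleftrightarrow> T \<subseteq> F \<and> connected_graph W T \<and> (\<nexists>c. is_cycle T c)"

definition degree_in :: "'a set set \<Rightarrow> 'a \<Rightarrow> nat" where
  "degree_in T x = card {d \<in> T. x \<in> d}"

text \<open>
  \<open>is_ear W F p\<close>: the path \<open>p\<close> is an ear that can be attached to the graph with vertices \<open>W\<close> and
  edges \<open>F\<close>. Its end points are distinct because \<open>p\<close> has at least two, pairwise distinct vertices.
\<close>

definition is_ear :: "'a set \<Rightarrow> 'a set set \<Rightarrow> 'a list \<Rightarrow> bool" where
  "is_ear W F p \<longleftrightarrow>
     length p \<ge> 2 \<and> distinct p \<and> hd p \<in> W \<and> last p \<in> W \<and>
     set (butlast (tl p)) \<inter> W = {} \<and> walk_edges p \<inter> F = {}"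

text \<open>
  \<open>builds W F ps W' F'\<close>: successively attaching the ears in \<open>ps\<close> to the graph \<open>(W, F)\<close>
  results in the graph \<open>(W', F')\<close>.
\<close>

fun builds :: "'a set \<Rightarrow> 'a set set \<Rightarrow> 'a list list \<Rightarrow> 'a set \<Rightarrow> 'a set set \<Rightarrow> bool" where
  "builds W F [] W' F' \<longleftrightarrow> W = W' \<and> F = F'"
| "builds W F (p # ps) W' F' \<longleftrightarrow>
     is_ear W F p \<and> builds (W \<union> set p) (F \<union> walk_edges p) ps W' F'"

definition ear_decomposition :: "'a set \<Rightarrow> 'a set set \<Rightarrow> 'a list \<Rightarrow> 'a list list \<Rightarrow> bool" where
  "ear_decomposition W F c ps \<longleftrightarrow> is_cycle F c \<and> builds (set c) (cycle_edges c) ps W F"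

text \<open>
  Functions on \<open>E\<close> are extensional (\<open>undefined\<close> outside \<open>E\<close>), so that each hypertree is
  represented, and hence counted, exactly once.
\<close>

definition hypertree :: "'a set \<Rightarrow> 'a set \<Rightarrow> 'a set set \<Rightarrow> ('a \<Rightarrow> nat) \<Rightarrow> bool" where
  "hypertree V E \<epsilon> f \<longleftrightarrow>
     f \<in> E \<rightarrow>\<^sub>E UNIV \<and>
     (\<exists>T. spanning_tree (V \<union> E) \<epsilon> T \<and> (\<forall>e\<in>E. degree_in T e = f e + 1))"

text \<open>The condition \<open>f e \<ge> 1\<close> makes the subtraction on natural numbers a genuine one.\<close>

definition can_transfer ::
    "'a set \<Rightarrow> 'a set \<Rightarrow> 'a set set \<Rightarrow> ('a \<Rightarrow> nat) \<Rightarrow> 'a \<Rightarrow> 'a \<Rightarrow> bool" where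
  "can_transfer V E \<epsilon> f e e' \<longleftrightarrow>
     e \<in> E \<and> e' \<in> E \<and> e \<noteq> e' \<and> f e \<ge> 1 \<and>
     hypertree V E \<epsilon> (f(e := f e - 1, e' := f e' + 1))"

text \<open>\<open>(e', e) \<in> r\<close> means that \<open>e'\<close> is at most \<open>e\<close> in the (reflexive) total order \<open>r\<close> on \<open>E\<close>.\<close>

definition internally_inactive ::
    "'a set \<Rightarrow> 'a set \<Rightarrow> 'a set set \<Rightarrow> 'a rel \<Rightarrow> ('a \<Rightarrow> nat) \<Rightarrow> 'a \<Rightarrow> bool" where
  "internally_inactive V E \<epsilon> r f e \<longleftrightarrow>
     (\<exists>e'. (e', e) \<in> r \<and> e' \<noteq> e \<and> can_transfer V E \<epsilon> f e e')"

definition internal_inactivity ::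
    "'a set \<Rightarrow> 'a set \<Rightarrow> 'a set set \<Rightarrow> 'a rel \<Rightarrow> ('a \<Rightarrow> nat) \<Rightarrow> nat" where
  "internal_inactivity V E \<epsilon> r f = card {e \<in> E. internally_inactive V E \<epsilon> r f e}"

definition interior_polynomial ::
    "'a set \<Rightarrow> 'a set \<Rightarrow> 'a set set \<Rightarrow> 'a rel \<Rightarrow> int poly" where
  "interior_polynomial V E \<epsilon> r =
     (\<Sum>f | hypertree V E \<epsilon> f. monom 1 (internal_inactivity V E \<epsilon> r f))"

lemma finite_hypertrees:
  assumes "bipartite_graph V E \<epsilon>"
  shows "finite {f. hypertree V E \<epsilon> f}"
proof -
  have "\<epsilon> \<subseteq> Pow (V \<union> E)" "finite (V \<union> E)"
    using assms by (auto simp: bipartite_graph_def)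
  then have fin: "finite \<epsilon>"
    by (meson finite_Pow_iff finite_subset)
  have "{f. hypertree V E \<epsilon> f} \<subseteq> (\<lambda>T. \<lambda>e\<in>E. degree_in T e - 1) ` Pow \<epsilon>"
  proof
    fix f assume "f \<in> {f. hypertree V E \<epsilon> f}"
    then obtain T where f: "f \<in> extensional E" and T: "T \<subseteq> \<epsilon>"
      and deg: "\<forall>e\<in>E. degree_in T e = f e + 1"
      by (auto simp: hypertree_def spanning_tree_def PiE_def)
    have "f = (\<lambda>e\<in>E. degree_in T e - 1)"
      using f deg by (auto simp: extensional_def fun_eq_iff)
    with T show "f \<in> (\<lambda>T. \<lambda>e\<in>E. degree_in T e - 1) ` Pow \<epsilon>"
      by blast
  qed
  then show ?thesis
    using fin by (meson finite_Pow_iff finite_imageI finite_subset)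
qed

end

theory Submission
  imports Defs
begin

text \<open>
  All hyperedges \<open>e\<close> but the least one, \<open>e0\<close>, being inactive forces \<open>f e \<ge> 1\<close> for \<open>e \<noteq> e0\<close>. As the
  values of a hypertree sum to \<open>n - 1\<close>, only the function that is \<open>0\<close> at \<open>e0\<close> and \<open>1\<close> elsewhere can
  contribute to the coefficient. It does so, because for every hyperedge \<open>e\<close> the function that
  is \<open>0\<close> at \<open>e\<close> and \<open>1\<close> elsewhere is a hypertree, so that \<open>e0\<close> can receive valence from all others.

  The spanning trees realising these functions arise along the ear decomposition. In the starting
  cycle, delete an edge at \<open>e\<close>. When attaching an ear with end point \<open>z \<in> E\<close>, take the tree for
  \<open>e\<close> and the ear without its last edge if \<open>e\<close> is an old vertex; if \<open>e\<close> is new, take the tree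
  for \<open>z\<close> and the ear without an edge at \<open>e\<close>.
\<close>

section \<open>Trees grown by adding leaves\<close>

text \<open>An inductive form of finite trees, each step hanging a new vertex \<open>w\<close> on an
  old vertex \<open>u\<close>. It gives the edge count, connectedness and acyclicity by induction;
  the passage to and from \<open>spanning_tree\<close> is proved below.\<close>

inductive leaf_grown :: "'a set \<Rightarrow> 'a set set \<Rightarrow> bool" where
  single: "leaf_grown {x} {}"
| add_leaf: "leaf_grown W T \<Longrightarrow> u \<in> W \<Longrightarrow> w \<notin> W \<Longrightarrow> leaf_grown (insert w W) (insert {u, w} T)"

lemma leaf_grown_finite: "leaf_grown W T \<Longrightarrow> finite W \<and> finite T"
  by (induction rule: leaf_grown.induct) auto

lemma leaf_grown_edges_subset: "leaf_grown W T \<Longrightarrow> d \<in> T \<Longrightarrow> d \<subseteq> W"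
  by (induction rule: leaf_grown.induct) auto

lemma leaf_grown_card: "leaf_grown W T \<Longrightarrow> card W = card T + 1"
proof (induction rule: leaf_grown.induct)
  case (add_leaf W T u w)
  then have "{u, w} \<notin> T"
    using leaf_grown_edges_subset by blast
  then show ?case
    using add_leaf leaf_grown_finite[OF add_leaf.hyps(1)] by simp
qed simp

section \<open>Walks and paths\<close>

lemma walk_edges_append:
  assumes "p \<noteq> []" "q \<noteq> []"
  shows "walk_edges (p @ q) = insert {last p, hd q} (walk_edges p \<union> walk_edges q)"
  using assms
proof (induction p rule: walk_edges.induct)
  case ("2_2" v) then show ?case by (cases q) auto
qed auto

lemma walk_edges_subset: "d \<in> walk_edges p \<Longrightarrow> d \<subseteq> set p"
  by (induction p rule: walk_edges.induct) auto

lemma finite_walk_edges: "finite (walk_edges p)"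
  by (induction p rule: walk_edges.induct) auto

lemma walk_edges_rev: "walk_edges (rev p) = walk_edges p"
proof (induction p rule: walk_edges.induct)
  case (1 x y p)
  have "walk_edges (rev (x # y # p)) = walk_edges (rev (y # p) @ [x])"
    by simp
  also have "\<dots> = insert {last (rev (y # p)), x} (walk_edges (rev (y # p)))"
    by (subst walk_edges_append) simp_all
  also have "\<dots> = insert {y, x} (walk_edges (y # p))"
    using 1 by simp
  finally show ?case
    by (simp add: insert_commute)
qed simp_all

text \<open>All vertices of the path after the first are new and distinct, so they can be attached
  one after the other as leaves.\<close>

lemma leaf_grown_add_path:
  assumes "leaf_grown W T" "p \<noteq> []" "hd p \<in> W" "distinct p" "set (tl p) \<inter> W = {}"
  shows "leaf_grown (W \<union> set p) (T \<union> walk_edges p)"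
  using assms
proof (induction p arbitrary: W T rule: walk_edges.induct)
  case (1 x y p)
  have "leaf_grown (insert y W) (insert {x, y} T)"
    using 1 by (intro leaf_grown.add_leaf) auto
  then have "leaf_grown (insert y W \<union> set (y # p)) (insert {x, y} T \<union> walk_edges (y # p))"
    using 1 by (intro "1.IH") auto
  moreover have "insert y W \<union> set (y # p) = W \<union> set (x # y # p)"
    using 1 by auto
  ultimately show ?case
    by simp
qed (auto simp: insert_absorb)

lemma leaf_grown_path: "distinct p \<Longrightarrow> p \<noteq> [] \<Longrightarrow> leaf_grown (set p) (walk_edges p)"
  using leaf_grown_add_path[OF leaf_grown.single[of "hd p"], of p]
  by (cases p) auto

text \<open>Only paths ending or starting at the new leaf \<open>w\<close> need work: extend a path
  to its neighbour \<open>u\<close> by \<open>w\<close>, and reverse it for the other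
  direction.\<close>

lemma leaf_grown_ex_path:
  assumes "leaf_grown W T" "x \<in> W" "y \<in> W"
  shows "\<exists>p. p \<noteq> [] \<and> hd p = x \<and> last p = y \<and> distinct p \<and> set p \<subseteq> W \<and> walk_edges p \<subseteq> T"
  using assms
proof (induction arbitrary: x y rule: leaf_grown.induct)
  case (single z)
  then show ?case by (intro exI[of _ "[z]"]) auto
next
  case (add_leaf W T u w)
  have to_w: "\<exists>p. p \<noteq> [] \<and> hd p = a \<and> last p = w \<and> distinct p \<and>
      set p \<subseteq> insert w W \<and> walk_edges p \<subseteq> insert {u, w} T" if a: "a \<in> W" for a
  proof -
    obtain p where "p \<noteq> []" "hd p = a" "last p = u" "distinct p" "set p \<subseteq> W" "walk_edges p \<subseteq> T"
      using add_leaf.IH[OF a add_leaf.hyps(2)] by auto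
    then show ?thesis
      using add_leaf.hyps by (intro exI[of _ "p @ [w]"]) (auto simp: walk_edges_append)
  qed
  have from_w: "\<exists>p. p \<noteq> [] \<and> hd p = w \<and> last p = a \<and> distinct p \<and>
      set p \<subseteq> insert w W \<and> walk_edges p \<subseteq> insert {u, w} T" if a: "a \<in> W" for a
  proof -
    obtain p where "p \<noteq> []" "hd p = a" "last p = w" "distinct p" "set p \<subseteq> insert w W"
        "walk_edges p \<subseteq> insert {u, w} T"
      using to_w[OF a] by auto
    then show ?thesis
      by (intro exI[of _ "rev p"]) (auto simp: walk_edges_rev hd_rev last_rev)
  qed
  consider "x = w" "y = w" | "x = w" "y \<in> W" | "x \<in> W" "y = w" | "x \<in> W" "y \<in> W"
    using add_leaf.prems by blast
  then show ?case
  proof cases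
    case 1 then show ?thesis by (intro exI[of _ "[w]"]) auto
  next
    case 2 then show ?thesis using from_w by blast
  next
    case 3 then show ?thesis using to_w by blast
  next
    case 4
    then show ?thesis using add_leaf.IH[OF 4] by blast
  qed
qed

lemma walk_imp_rtrancl:
  assumes "p \<noteq> []" "set p \<subseteq> W" "walk_edges p \<subseteq> T"
  shows "(hd p, last p) \<in> {(a, b). a \<in> W \<and> b \<in> W \<and> {a, b} \<in> T}\<^sup>*"
  using assms
proof (induction p rule: walk_edges.induct)
  case (1 x y p)
  then show ?case
    by (auto intro: converse_rtrancl_into_rtrancl)
qed auto

lemma leaf_grown_connected: "leaf_grown W T \<Longrightarrow> connected_graph W T"
  unfolding connected_graph_def
proof (intro conjI ballI)
  show "W \<noteq> {}" if "leaf_grown W T"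
    using that by (induction rule: leaf_grown.induct) auto
  fix x y assume "leaf_grown W T" "x \<in> W" "y \<in> W"
  then obtain p where "p \<noteq> []" "hd p = x" "last p = y" "set p \<subseteq> W" "walk_edges p \<subseteq> T"
    using leaf_grown_ex_path by metis
  then show "(x, y) \<in> {(a, b). a \<in> W \<and> b \<in> W \<and> {a, b} \<in> T}\<^sup>*"
    using walk_imp_rtrancl[of p W T] by simp
qed

section \<open>Rotation of cycles and acyclicity of leaf-grown trees\<close>

lemma cycle_edges_rotate:
  assumes "c = p @ x # q"
  shows "cycle_edges c = cycle_edges (x # q @ p)"
proof (cases "p = []")
  case False
  let ?q = "x # q"
  \<comment> \<open>Both closed walks consist of the edges of \<open>p\<close>, those of
    \<open>?q\<close>, and the two edges joining these pieces.\<close>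
  have "cycle_edges c = walk_edges (p @ ?q @ [hd p])"
    using assms False by (simp add: cycle_edges_def)
  also have "\<dots> = insert {last p, x} (walk_edges p \<union> insert {last ?q, hd p} (walk_edges ?q))"
    using False walk_edges_append[of p "?q @ [hd p]"] walk_edges_append[of ?q "[hd p]"] by simp
  also have "\<dots> = insert {last ?q, hd p} (walk_edges ?q \<union> insert {last p, x} (walk_edges p))"
    by blast
  also have "\<dots> = walk_edges (?q @ p @ [x])"
    using False walk_edges_append[of ?q "p @ [x]"] walk_edges_append[of p "[x]"] by simp
  finally show ?thesis
    by (simp add: cycle_edges_def)
qed (use assms in simp)

lemma is_cycle_rotate:
  assumes "is_cycle T c" "x \<in> set c"
  obtains q where "is_cycle T (x # q)" "set (x # q) = set c" "cycle_edges (x # q) = cycle_edges c"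
proof -
  obtain p q where c: "c = p @ x # q"
    using assms(2) by (meson split_list)
  have "is_cycle T (x # q @ p)"
    using assms(1) cycle_edges_rotate[OF c] by (auto simp: is_cycle_def c)
  moreover have "set (x # q @ p) = set c"
    by (auto simp: c)
  ultimately show ?thesis
    using that cycle_edges_rotate[OF c] by metis
qed

lemma cycle_edges_Cons:
  "q \<noteq> [] \<Longrightarrow> cycle_edges (x # q) = {{x, hd q}, {last q, x}} \<union> walk_edges q"
  using walk_edges_append[of "[x]" "q @ [x]"] walk_edges_append[of q "[x]"]
  by (simp add: cycle_edges_def)

text \<open>After rotating the cycle to start at \<open>x\<close>, the neighbours are the second and
  the last vertex; they differ because a cycle has at least three vertices.\<close>

lemma cycle_vertex_two_edges:
  assumes "is_cycle T c" "x \<in> set c"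
  shows "\<exists>a b. a \<noteq> b \<and> a \<noteq> x \<and> b \<noteq> x \<and> {a, b} \<subseteq> set c \<and> {x, a} \<in> T \<and> {x, b} \<in> T"
proof -
  obtain q where q: "is_cycle T (x # q)" "set (x # q) = set c"
    using is_cycle_rotate[OF assms] by metis
  then obtain a b q' where ab: "q = a # b # q'"
    by (auto simp: is_cycle_def Suc_le_length_iff numeral_3_eq_3)
  have "last q \<in> set (b # q')"
    by (simp add: ab)
  then have "a \<noteq> last q" "a \<noteq> x" "last q \<noteq> x" "{a, last q} \<subseteq> set c"
    using q ab by (auto simp: is_cycle_def)
  moreover have "{x, a} \<in> T" "{x, last q} \<in> T"
    using q(1) cycle_edges_Cons[of q x] ab by (auto simp: is_cycle_def insert_commute)
  ultimately show ?thesis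
    by blast
qed

text \<open>A vertex on a cycle has two neighbours, but the new leaf \<open>w\<close> has only
  \<open>u\<close>. So a cycle avoids \<open>w\<close> and already lies in the smaller tree.\<close>

lemma leaf_grown_acyclic: "leaf_grown W T \<Longrightarrow> \<not> is_cycle T c"
proof (induction arbitrary: c rule: leaf_grown.induct)
  case (single x)
  show ?case
  proof
    assume c: "is_cycle {} c"
    then have "hd c \<in> set c"
      by (cases c) (auto simp: is_cycle_def)
    then show False
      using cycle_vertex_two_edges[OF c] by blast
  qed
next
  case (add_leaf W T u w)
  show ?case
  proof
    assume c: "is_cycle (insert {u, w} T) c"
    have noT: "{w, a} \<notin> T" for a
      using leaf_grown_edges_subset[OF add_leaf.hyps(1)] add_leaf.hyps(3) by blast
    have "w \<notin> set c"
    proof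
      assume "w \<in> set c"
      then obtain a b where "a \<noteq> b" "a \<noteq> w" "b \<noteq> w" "{w, a} \<in> insert {u, w} T" "{w, b} \<in> insert {u, w} T"
        using cycle_vertex_two_edges[OF c] by metis
      then show False
        using noT by (auto simp: doubleton_eq_iff)
    qed
    then have "{u, w} \<notin> cycle_edges c"
      using walk_edges_subset[of "{u, w}" "c @ [hd c]"] c
      by (cases c) (auto simp: cycle_edges_def is_cycle_def)
    then have "is_cycle T c"
      using c by (auto simp: is_cycle_def)
    then show False
      using add_leaf.IH by blast
  qed
qed

lemma leaf_grown_spanning_tree: "leaf_grown W T \<Longrightarrow> T \<subseteq> F \<Longrightarrow> spanning_tree W F T"
  by (simp add: spanning_tree_def leaf_grown_connected leaf_grown_acyclic)

section \<open>Spanning trees are leaf-grown\<close>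

lemma connected_graph_crossing_edge:
  assumes "connected_graph W T" "A \<subseteq> W" "A \<noteq> {}" "A \<noteq> W"
  shows "\<exists>u\<in>A. \<exists>w\<in>W - A. {u, w} \<in> T"
proof (rule ccontr)
  assume no: "\<not> ?thesis"
  obtain x y where "x \<in> A" "y \<in> W - A"
    using assms by blast
  then have "(x, y) \<in> {(a, b). a \<in> W \<and> b \<in> W \<and> {a, b} \<in> T}\<^sup>*"
    using assms by (auto simp: connected_graph_def)
  then have "y \<in> A"
    by (induction rule: rtrancl_induct) (use \<open>x \<in> A\<close> no in auto)
  with \<open>y \<in> W - A\<close> show False
    by simp
qed

text \<open>Take a maximal vertex set \<open>A\<close> carrying a leaf-grown tree inside
  \<open>T\<close>. If \<open>A\<close> were not \<open>W\<close>, an edge of \<open>T\<close>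
  leaving \<open>A\<close> would attach one more leaf.\<close>

lemma connected_graph_ex_leaf_grown:
  assumes "finite W" "connected_graph W T"
  shows "\<exists>T'\<subseteq>T. leaf_grown W T'"
proof -
  define P where "P A \<longleftrightarrow> A \<subseteq> W \<and> (\<exists>T'\<subseteq>T. leaf_grown A T')" for A
  obtain x where "x \<in> W"
    using assms(2) by (auto simp: connected_graph_def)
  then have "P {x}"
    by (auto simp: P_def intro!: exI[of _ "{}"] leaf_grown.single)
  moreover have "finite (Collect P)"
    by (rule finite_subset[of _ "Pow W"]) (use assms in \<open>auto simp: P_def\<close>)
  ultimately obtain A where "P A" and max: "\<forall>B\<in>Collect P. A \<subseteq> B \<longrightarrow> A = B"
    using finite_has_maximal[of "Collect P"] by auto
  then have A: "A \<subseteq> W" "\<exists>T'\<subseteq>T. leaf_grown A T'"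
    by (simp_all add: P_def)
  from A(2) obtain T' where T': "T' \<subseteq> T" "leaf_grown A T'"
    by blast
  have "A = W"
  proof (rule ccontr)
    assume "A \<noteq> W"
    moreover have "A \<noteq> {}"
      using leaf_grown_connected[OF T'(2)] by (simp add: connected_graph_def)
    ultimately obtain u w where uw: "u \<in> A" "w \<in> W - A" "{u, w} \<in> T"
      using connected_graph_crossing_edge[OF assms(2) A(1)] by blast
    then have "leaf_grown (insert w A) (insert {u, w} T')"
      using T' by (intro leaf_grown.add_leaf) auto
    moreover have "insert w A \<subseteq> W" "insert {u, w} T' \<subseteq> T"
      using A(1) T'(1) uw by auto
    ultimately have "P (insert w A)"
      unfolding P_def by blast
    then show False
      using max uw by blast
  qed
  then show ?thesis
    using T' by blast
qed

text \<open>By connectedness \<open>T\<close> contains a leaf-grown tree \<open>T'\<close> on all of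
  \<open>W\<close>. An edge of \<open>T\<close> outside \<open>T'\<close> would close a cycle with
  the path of \<open>T'\<close> between its ends.\<close>

lemma spanning_tree_leaf_grown:
  assumes "finite W" "spanning_tree W F T"
    and edges: "\<And>d. d \<in> F \<Longrightarrow> \<exists>a\<in>W. \<exists>b\<in>W. a \<noteq> b \<and> d = {a, b}"
  shows "leaf_grown W T"
proof -
  obtain T' where T': "T' \<subseteq> T" "leaf_grown W T'"
    using connected_graph_ex_leaf_grown assms by (metis spanning_tree_def)
  have "d \<in> T'" if d: "d \<in> T" for d
  proof (rule ccontr)
    assume "d \<notin> T'"
    obtain a b where ab: "a \<in> W" "b \<in> W" "a \<noteq> b" "d = {a, b}"
      using edges d assms(2) by (meson spanning_tree_def subsetD)
    then obtain p where p: "p \<noteq> []" "hd p = a" "last p = b" "distinct p" "walk_edges p \<subseteq> T'"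
      using leaf_grown_ex_path[OF T'(2)] by metis
    then obtain q where q: "p = a # q" "q \<noteq> []"
      using ab by (cases p) (auto split: if_splits)
    then obtain y q' where q': "q = y # q'"
      by (cases q) auto
    \<comment> \<open>Otherwise the path in \<open>T'\<close> would be the single edge
      \<open>d\<close>, which is not in \<open>T'\<close>. Hence \<open>p\<close> has the three
      vertices a cycle requires.\<close>
    have "q' \<noteq> []"
      using p ab \<open>d \<notin> T'\<close> q q' by auto
    moreover have "cycle_edges p \<subseteq> T"
      using p q q' ab d T'(1) cycle_edges_Cons[of q a] by (auto simp: insert_commute)
    ultimately have "is_cycle T p"
      using p q q' by (cases q') (auto simp: is_cycle_def)
    then show False
      using assms(2) by (auto simp: spanning_tree_def)
  qed
  then show ?thesis
    using T' by (metis subsetI subset_antisym)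
qed

section \<open>Degrees\<close>

lemma degree_in_Un_disjoint:
  "finite A \<Longrightarrow> finite B \<Longrightarrow> A \<inter> B = {} \<Longrightarrow> degree_in (A \<union> B) x = degree_in A x + degree_in B x"
proof -
  assume "finite A" "finite B" "A \<inter> B = {}"
  moreover have "{d \<in> A \<union> B. x \<in> d} = {d \<in> A. x \<in> d} \<union> {d \<in> B. x \<in> d}"
    by auto
  ultimately show ?thesis
    by (simp add: degree_in_def) (subst card_Un_disjoint; auto)
qed

lemma degree_in_remove:
  assumes "finite A" "d \<in> A"
  shows "degree_in (A - {d}) x = degree_in A x - (if x \<in> d then 1 else 0)"
proof -
  have "{d' \<in> A - {d}. x \<in> d'} = {d' \<in> A. x \<in> d'} - {d}"
    by auto
  then show ?thesis
    using assms by (simp add: degree_in_def)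
qed

lemma degree_in_outside: "(\<And>d. d \<in> T \<Longrightarrow> x \<notin> d) \<Longrightarrow> degree_in T x = 0"
  by (auto simp: degree_in_def card_eq_0_iff)

text \<open>The first edge is split off: \<open>a\<close> lies on no further edge, and
  \<open>b\<close> turns from an end point of the rest into an inner vertex, unless nothing follows
  it.\<close>

lemma degree_in_path:
  assumes "distinct p" "length p \<ge> 2" "x \<in> set p"
  shows "degree_in (walk_edges p) x = (if x = hd p \<or> x = last p then 1 else 2)"
  using assms
proof (induction p rule: walk_edges.induct)
  case (1 a b p)
  have new: "{a, b} \<notin> walk_edges (b # p)"
    using 1 walk_edges_subset[of "{a, b}" "b # p"] by auto
  have split: "degree_in (walk_edges (a # b # p)) x
      = degree_in {{a, b}} x + degree_in (walk_edges (b # p)) x"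
    using degree_in_Un_disjoint[of "{{a, b}}" "walk_edges (b # p)" x] new
    by (simp add: finite_walk_edges)
  have single: "degree_in {{a, b}} x = (if x = a \<or> x = b then 1 else 0)"
  proof (cases "x = a \<or> x = b")
    case True
    then have "{d \<in> {{a, b}}. x \<in> d} = {{a, b}}"
      by auto
    then show ?thesis
      using True by (simp add: degree_in_def)
  qed (auto intro!: degree_in_outside)
  show ?case
  proof (cases "x = a")
    case True
    then have "degree_in (walk_edges (b # p)) x = 0"
      using 1 walk_edges_subset[of _ "b # p"] by (intro degree_in_outside) auto
    then show ?thesis
      using True split single by simp
  next
    case False
    show ?thesis
    proof (cases "p = []")
      case True
      then show ?thesis
        using False split single 1 by (auto simp: degree_in_def)
    next
      case ne: False
      then have "degree_in (walk_edges (b # p)) x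
          = (if x = hd (b # p) \<or> x = last (b # p) then 1 else 2)"
        using 1 False by (intro "1.IH") (auto simp: Suc_le_eq)
      moreover have "b \<noteq> last p"
        using 1 ne by auto
      ultimately show ?thesis
        using False split single 1 ne by auto
    qed
  qed
qed auto

section \<open>Attaching an ear with one edge deleted\<close>

lemma path_remove_edge:
  assumes "distinct p" "d \<in> walk_edges p"
  obtains p1 p2 where "p = p1 @ p2" "p1 \<noteq> []" "p2 \<noteq> []"
    "walk_edges p - {d} = walk_edges p1 \<union> walk_edges p2"
proof -
  have "\<exists>p1 p2. p = p1 @ p2 \<and> p1 \<noteq> [] \<and> p2 \<noteq> [] \<and> d = {last p1, hd p2}"
    using assms(2)
  proof (induction p rule: walk_edges.induct)
    case (1 x y p)
    show ?case
    proof (cases "d = {x, y}")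
      case True
      then show ?thesis
        by (intro exI[of _ "[x]"] exI[of _ "y # p"]) auto
    next
      case False
      then obtain p1 p2 where "y # p = p1 @ p2" "p1 \<noteq> []" "p2 \<noteq> []" "d = {last p1, hd p2}"
        using 1 by auto
      then show ?thesis
        by (intro exI[of _ "x # p1"] exI[of _ p2]) auto
    qed
  qed auto
  then obtain p1 p2 where p: "p = p1 @ p2" "p1 \<noteq> []" "p2 \<noteq> []" "d = {last p1, hd p2}"
    by blast
  \<comment> \<open>The ends of \<open>d\<close> lie in different pieces, which are disjoint as
    \<open>p\<close> is distinct; so neither piece contains the edge \<open>d\<close>.\<close>
  have "last p1 \<in> set p1" "hd p2 \<in> set p2"
    using p by auto
  then have "\<not> d \<subseteq> set p1" "\<not> d \<subseteq> set p2"
    using p(1,4) assms(1) \<open>last p1 \<in> set p1\<close> \<open>hd p2 \<in> set p2\<close> by auto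
  then have "d \<notin> walk_edges p1" "d \<notin> walk_edges p2"
    using walk_edges_subset by metis+
  then have "walk_edges p - {d} = walk_edges p1 \<union> walk_edges p2"
    using p by (auto simp: walk_edges_append)
  then show ?thesis
    using that p by blast
qed

text \<open>Deleting \<open>d\<close> splits the ear into two paths, each hanging on one end point
  in \<open>W\<close>. The second is traversed backwards so that it, too, starts in \<open>W\<close>
  and then meets only new vertices.\<close>

lemma leaf_grown_add_ear:
  assumes "leaf_grown W T" "is_ear W F p" "d \<in> walk_edges p"
  shows "leaf_grown (W \<union> set p) (T \<union> (walk_edges p - {d}))"
proof -
  have dist: "distinct p" and ends: "hd p \<in> W" "last p \<in> W" and inner: "set (butlast (tl p)) \<inter> W = {}"
    using assms by (auto simp: is_ear_def)
  obtain p1 p2 where p: "p = p1 @ p2" "p1 \<noteq> []" "p2 \<noteq> []"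
    "walk_edges p - {d} = walk_edges p1 \<union> walk_edges p2"
    using path_remove_edge[OF dist assms(3)] by metis
  have tl: "butlast (tl p) = tl p1 @ butlast p2"
    using p by (simp add: butlast_append)
  have "leaf_grown (W \<union> set p1) (T \<union> walk_edges p1)"
    using assms(1) p dist ends inner tl by (intro leaf_grown_add_path) auto
  then have "leaf_grown ((W \<union> set p1) \<union> set (rev p2)) ((T \<union> walk_edges p1) \<union> walk_edges (rev p2))"
  proof (rule leaf_grown_add_path)
    show "set (tl (rev p2)) \<inter> (W \<union> set p1) = {}"
    proof -
      have "tl (rev p2) = rev (butlast p2)"
        by (metis butlast_rev rev_rev_ident)
      then show ?thesis
        using inner dist tl p by (auto dest: in_set_butlastD)
    qed
  qed (use p dist ends in \<open>auto simp: hd_rev\<close>)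
  then show ?thesis
    using p by (simp add: walk_edges_rev Un_assoc)
qed

section \<open>Spanning trees along an ear decomposition\<close>

text \<open>The invariant of the construction. Tree degrees exceed hypertree values by 1, so degree
  1 at \<open>e\<close> and 2 elsewhere encodes the value 0 at \<open>e\<close> and 1 elsewhere.
  Only hyperedges in \<open>W\<close> count, since the others are not attached yet.\<close>

definition has_special_trees :: "'a set \<Rightarrow> 'a set \<Rightarrow> 'a set set \<Rightarrow> bool" where
  "has_special_trees E W F \<longleftrightarrow> (\<forall>e\<in>E \<inter> W. \<exists>T\<subseteq>F. leaf_grown W T \<and>
     (\<forall>x\<in>E \<inter> W. degree_in T x = (if x = e then 1 else 2)))"

lemma bipartite_edge_E_unique:
  assumes "bipartite_graph V E \<epsilon>" "d \<in> \<epsilon>" "x \<in> d" "y \<in> d" "x \<in> E" "y \<in> E"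
  shows "x = y"
  using assms by (auto simp: bipartite_graph_def)

text \<open>The path left after deleting an edge at \<open>e\<close> ends in \<open>e\<close> and in
  a neighbour of \<open>e\<close>. The latter is not in \<open>E\<close> by bipartiteness, so all
  other hyperedges are inner vertices, of degree 2.\<close>

lemma has_special_trees_cycle:
  assumes "bipartite_graph V E \<epsilon>" "is_cycle \<epsilon> c"
  shows "has_special_trees E (set c) (cycle_edges c)"
  unfolding has_special_trees_def
proof
  fix e assume e: "e \<in> E \<inter> set c"
  then obtain q where q: "is_cycle \<epsilon> (e # q)" "set (e # q) = set c"
      "cycle_edges (e # q) = cycle_edges c"
    using is_cycle_rotate[OF assms(2)] by (metis IntD2)
  then have len: "q \<noteq> []" "length (e # q) \<ge> 2" "distinct (e # q)"
    by (auto simp: is_cycle_def)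
  have "{last q, e} \<in> \<epsilon>"
    using q len cycle_edges_Cons[of q e] by (auto simp: is_cycle_def)
  moreover have "last q \<noteq> e"
    using len by (metis distinct.simps(2) last_in_set)
  ultimately have "last q \<notin> E"
    using bipartite_edge_E_unique[OF assms(1)] e by blast
  then have "degree_in (walk_edges (e # q)) x = (if x = e then 1 else 2)" if "x \<in> E \<inter> set c" for x
    using degree_in_path[OF len(3,2), of x] that len(1) q(2) by auto
  moreover have "walk_edges (e # q) \<subseteq> cycle_edges c"
    using walk_edges_append[of "e # q" "[e]"] q(3) by (auto simp: cycle_edges_def)
  moreover have "leaf_grown (set c) (walk_edges (e # q))"
    using leaf_grown_path[of "e # q"] len q by simp
  ultimately show "\<exists>T\<subseteq>cycle_edges c. leaf_grown (set c) T \<and>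
      (\<forall>x\<in>E \<inter> set c. degree_in T x = (if x = e then 1 else 2))"
    by blast
qed

lemma path_vertex_edge:
  assumes "length p \<ge> 2" "x \<in> set p"
  shows "\<exists>d\<in>walk_edges p. x \<in> d"
  using assms
proof (induction p rule: walk_edges.induct)
  case (1 a b p)
  then show ?case
    by (cases p) auto
qed auto

lemma has_special_trees_add_ear:
  assumes bip: "bipartite_graph V E \<epsilon>"
    and IH: "has_special_trees E W F"
    and ear: "is_ear W F p" and sub: "walk_edges p \<subseteq> \<epsilon>"
    and ends: "hd p \<in> V" "last p \<in> E"
  shows "has_special_trees E (W \<union> set p) (F \<union> walk_edges p)"
  unfolding has_special_trees_def
proof
  fix e assume e: "e \<in> E \<inter> (W \<union> set p)"
  have p: "length p \<ge> 2" "distinct p" "hd p \<in> W" "last p \<in> W"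
      "set (butlast (tl p)) \<inter> W = {}" "walk_edges p \<inter> F = {}"
    using ear by (auto simp: is_ear_def)
  then have ne: "p \<noteq> []" "tl p \<noteq> []"
    by (auto simp: Suc_le_length_iff numeral_2_eq_2)
  have hdE: "hd p \<notin> E"
    using bip ends by (auto simp: bipartite_graph_def)
  \<comment> \<open>The inner vertices of the ear are new and \<open>hd p\<close> is in
    \<open>V\<close>, so ear and old graph share just one hyperedge.\<close>
  have old: "x = last p" if "x \<in> set p" "x \<in> W" "x \<in> E" for x
  proof -
    have "set p = insert (hd p) (insert (last p) (set (butlast (tl p))))"
      using ne by (metis append_butlast_last_id hd_Cons_tl insert_commute last_tl list.simps(15)
          rotate1.simps(2) set_rotate1)
    then show ?thesis
      using that p hdE by auto
  qed
  \<comment> \<open>\<open>y\<close> selects the old tree, and \<open>z\<close> is the hyperedge at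
    which the ear loses an edge. For old \<open>e\<close>, the ear adds nothing to the degree of
    \<open>last p\<close>. For new \<open>e\<close>, it raises the degree of \<open>last p\<close>
    from 1 to 2, and \<open>e\<close> keeps one of its two ear edges.\<close>
  define y where "y = (if e \<in> W then e else last p)"
  define z where "z = (if e \<in> W then last p else e)"
  have "y \<in> E \<inter> W" "z \<in> set p" "z \<in> E"
    using e p ends ne by (auto simp: y_def z_def)
  obtain d where d: "d \<in> walk_edges p" "z \<in> d"
    using path_vertex_edge[OF p(1) \<open>z \<in> set p\<close>] by blast
  obtain T where T: "T \<subseteq> F" "leaf_grown W T"
      "\<forall>x\<in>E \<inter> W. degree_in T x = (if x = y then 1 else 2)"
    using IH \<open>y \<in> E \<inter> W\<close> unfolding has_special_trees_def by blast
  let ?T = "T \<union> (walk_edges p - {d})"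
  have "degree_in ?T x = (if x = e then 1 else 2)" if x: "x \<in> E \<inter> (W \<union> set p)" for x
  proof -
    \<comment> \<open>An edge contains only one hyperedge, so deleting \<open>d\<close> changes no
      hyperedge degree except that of \<open>z\<close>.\<close>
    have xd: "x \<in> d \<longleftrightarrow> x = z"
      using bipartite_edge_E_unique[OF bip, of d x z] sub d x \<open>z \<in> E\<close> by blast
    have "degree_in ?T x = degree_in T x + degree_in (walk_edges p - {d}) x"
      using T p leaf_grown_finite[OF T(2)]
      by (intro degree_in_Un_disjoint) (auto simp: finite_walk_edges)
    also have "degree_in (walk_edges p - {d}) x
        = degree_in (walk_edges p) x - (if x = z then 1 else 0)"
      using degree_in_remove[OF finite_walk_edges d(1), of x] xd by simp
    finally have deg: "degree_in ?T x
        = degree_in T x + (degree_in (walk_edges p) x - (if x = z then 1 else 0))" .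
    have path: "degree_in (walk_edges p) x
        = (if x \<notin> set p then 0 else if x = last p then 1 else 2)"
    proof (cases "x \<in> set p")
      case True
      moreover have "x \<noteq> hd p"
        using x hdE by auto
      ultimately show ?thesis
        using degree_in_path[OF p(2,1) True] by simp
    qed (use walk_edges_subset[of _ p] in \<open>auto intro!: degree_in_outside\<close>)
    have tree: "degree_in T x = (if x \<notin> W then 0 else if x = y then 1 else 2)"
    proof (cases "x \<in> W")
      case False
      then show ?thesis
        using leaf_grown_edges_subset[OF T(2)] by (auto intro!: degree_in_outside)
    qed (use T x in auto)
    have "x = last p \<longleftrightarrow> x \<in> W \<and> x \<in> set p" "x \<in> W \<or> x \<in> set p"
      using old[of x] x p(4) ne by auto
    then show ?thesis
      unfolding deg path tree y_def z_def
      by (cases "e \<in> W"; cases "x \<in> W"; cases "x \<in> set p"; cases "x = e") simp_all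
  qed
  moreover have "leaf_grown (W \<union> set p) ?T"
    using leaf_grown_add_ear[OF T(2) ear d(1)] .
  moreover have "?T \<subseteq> F \<union> walk_edges p"
    using T by auto
  ultimately show "\<exists>T\<subseteq>F \<union> walk_edges p. leaf_grown (W \<union> set p) T \<and>
      (\<forall>x\<in>E \<inter> (W \<union> set p). degree_in T x = (if x = e then 1 else 2))"
    by blast
qed

text \<open>This keeps the edges of every intermediate ear inside \<epsilon>, where bipartiteness
  applies.\<close>

lemma builds_mono: "builds W F ps W' F' \<Longrightarrow> F \<subseteq> F'"
  by (induction ps arbitrary: W F) fastforce+

lemma has_special_trees_builds:
  assumes "bipartite_graph V E \<epsilon>" "has_special_trees E W F" "builds W F ps W' \<epsilon>"
    and "\<forall>p\<in>set ps. hd p \<in> V \<and> last p \<in> E"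
  shows "has_special_trees E W' \<epsilon>"
  using assms(2-)
proof (induction ps arbitrary: W F)
  case (Cons p ps)
  then have "has_special_trees E (W \<union> set p) (F \<union> walk_edges p)"
    using builds_mono[of "W \<union> set p" "F \<union> walk_edges p" ps W' \<epsilon>]
    by (intro has_special_trees_add_ear[OF assms(1)]) auto
  then show ?case
    using Cons by auto
qed simp

section \<open>Hypertrees\<close>

text \<open>Double counting of a realising tree: it has \<open>card V + card E - 1\<close> edges,
  and as each contains exactly one hyperedge, their number is also the sum of the hyperedge degrees
  \<open>f e + 1\<close>.\<close>

lemma hypertree_sum:
  assumes "bipartite_graph V E \<epsilon>" "hypertree V E \<epsilon> f"
  shows "sum f E + 1 = card V"
proof -
  have fin: "finite V" "finite E" and disj: "V \<inter> E = {}"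
    and eps: "\<epsilon> \<subseteq> {{v, e} | v e. v \<in> V \<and> e \<in> E}"
    using assms(1) by (auto simp: bipartite_graph_def)
  obtain T where T: "spanning_tree (V \<union> E) \<epsilon> T" "\<forall>e\<in>E. degree_in T e = f e + 1"
    using assms(2) by (auto simp: hypertree_def)
  then have sub: "T \<subseteq> \<epsilon>"
    by (simp add: spanning_tree_def)
  have grown: "leaf_grown (V \<union> E) T"
  proof (rule spanning_tree_leaf_grown[OF _ T(1)])
    fix d assume "d \<in> \<epsilon>"
    then obtain v e where "d = {v, e}" "v \<in> V" "e \<in> E"
      using eps by blast
    then show "\<exists>a\<in>V \<union> E. \<exists>b\<in>V \<union> E. a \<noteq> b \<and> d = {a, b}"
      using disj by (intro bexI[of _ v] bexI[of _ e]) auto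
  qed (use fin in simp)
  then have "finite T"
    using leaf_grown_finite by blast
  have "\<exists>e\<in>E. e \<in> d" if "d \<in> T" for d
  proof -
    have "d \<in> {{v, e} | v e. v \<in> V \<and> e \<in> E}"
      using that sub eps by auto
    then show ?thesis
      by auto
  qed
  then have "T = (\<Union>e\<in>E. {d \<in> T. e \<in> d})"
    by auto
  moreover have "card (\<Union>e\<in>E. {d \<in> T. e \<in> d}) = (\<Sum>e\<in>E. degree_in T e)"
    unfolding degree_in_def
  proof (rule card_UN_disjoint)
    show "\<forall>i\<in>E. \<forall>j\<in>E. i \<noteq> j \<longrightarrow> {d \<in> T. i \<in> d} \<inter> {d \<in> T. j \<in> d} = {}"
    proof (intro ballI impI)
      fix i j assume "i \<in> E" "j \<in> E" "i \<noteq> j"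
      then have "\<not> (i \<in> d \<and> j \<in> d)" if "d \<in> T" for d
        using bipartite_edge_E_unique[OF assms(1), of d i j] that sub by auto
      then show "{d \<in> T. i \<in> d} \<inter> {d \<in> T. j \<in> d} = {}"
        by auto
    qed
  qed (use fin \<open>finite T\<close> in auto)
  ultimately have "card T = (\<Sum>e\<in>E. f e + 1)"
    using T(2) by simp
  also have "\<dots> = sum f E + card E"
    by (simp only: sum.distrib) simp
  finally show ?thesis
    using leaf_grown_card[OF grown] card_Un_disjoint[OF fin disj] by simp
qed

section \<open>The least hyperedge and the coefficient at \<open>n - 1\<close>\<close>

lemma linear_order_finite_least:
  assumes "linear_order_on E r" "finite E" "E \<noteq> {}"
  shows "\<exists>m\<in>E. \<forall>x\<in>E. (m, x) \<in> r"
proof -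
  have r: "refl_on E r" "trans r" "total_on E r"
    using assms(1) by (auto simp: linear_order_on_def partial_order_on_def preorder_on_def)
  have "\<exists>m\<in>A. \<forall>x\<in>A. (m, x) \<in> r" if "finite A" "A \<noteq> {}" "A \<subseteq> E" for A
    using that
  proof (induction A rule: finite_ne_induct)
    case (singleton x)
    then show ?case
      using r(1) by (auto dest: refl_onD)
  next
    case (insert x A)
    then obtain m where m: "m \<in> A" "\<forall>x\<in>A. (m, x) \<in> r"
      by auto
    have x: "(x, x) \<in> r" and "x \<noteq> m"
      using insert r(1) m by (auto dest: refl_onD)
    then have "(x, m) \<in> r \<or> (m, x) \<in> r"
      using r(3) insert.prems m(1) by (auto simp: total_on_def)
    then show ?case
    proof
      assume "(x, m) \<in> r"
      then have "\<forall>a\<in>A. (x, a) \<in> r"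
        using m r(2) by (meson transD)
      with x show ?thesis
        by blast
    qed (use m in blast)
  qed
  then show ?thesis
    using assms by blast
qed

theorem theorem32:
  fixes V E :: "'a set" and \<epsilon> :: "'a set set" and r :: "'a rel" and n :: nat
  assumes "bipartite_graph V E \<epsilon>"
    and "two_connected_graph (V \<union> E) \<epsilon>"
    and "card V = n" and "card E = n"
    and "linear_order_on E r"
    and "\<exists>c ears. ear_decomposition (V \<union> E) \<epsilon> c ears \<and>
           (\<forall>p\<in>set ears. hd p \<in> V \<and> last p \<in> E)"
  shows "coeff (interior_polynomial V E \<epsilon> r) (n - 1) = 1"
proof -
  have fin: "finite E" "E \<noteq> {}"
    using assms(1) by (auto simp: bipartite_graph_def)
  obtain e0 where e0: "e0 \<in> E" "\<And>x. x \<in> E \<Longrightarrow> (e0, x) \<in> r"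
    using linear_order_finite_least[OF assms(5) fin] by blast
  have antisym: "antisym r"
    using assms(5) by (auto simp: linear_order_on_def partial_order_on_def)
  \<comment> \<open>Restricting to \<open>E\<close> makes \<open>g e\<close> extensional, as
    \<open>hypertree\<close> demands.\<close>
  define g where "g e = (\<lambda>x\<in>E. if x = e then 0 else 1 :: nat)" for e
  obtain c ears where "is_cycle \<epsilon> c" "builds (set c) (cycle_edges c) ears (V \<union> E) \<epsilon>"
      "\<forall>p\<in>set ears. hd p \<in> V \<and> last p \<in> E"
    using assms(6) by (auto simp: ear_decomposition_def)
  then have "has_special_trees E (V \<union> E) \<epsilon>"
    using has_special_trees_builds[OF assms(1)] has_special_trees_cycle[OF assms(1)] by blast
  then have hyp: "hypertree V E \<epsilon> (g e)" if e: "e \<in> E" for e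
  proof -
    obtain T where "T \<subseteq> \<epsilon>" "leaf_grown (V \<union> E) T"
        "\<forall>x\<in>E. degree_in T x = (if x = e then 1 else 2)"
      using \<open>has_special_trees E (V \<union> E) \<epsilon>\<close> e by (auto simp: has_special_trees_def)
    then show ?thesis
      using leaf_grown_spanning_tree[of "V \<union> E" T \<epsilon>]
      by (auto simp: hypertree_def g_def intro!: exI[of _ T])
  qed
  \<comment> \<open>By antisymmetry no other hyperedge lies below \<open>e0\<close> that could
    receive valence from it.\<close>
  have least_active: "\<not> internally_inactive V E \<epsilon> r f e0" for f
    using e0 antisym by (auto simp: internally_inactive_def can_transfer_def dest: antisymD)
  \<comment> \<open>Since \<open>e0\<close> is never inactive, \<open>n - 1\<close> is the largest
    possible count and is attained only if all others are inactive.\<close>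
  have inactive: "internal_inactivity V E \<epsilon> r f = n - 1 \<longleftrightarrow>
      (\<forall>e\<in>E - {e0}. internally_inactive V E \<epsilon> r f e)" for f
  proof -
    let ?I = "{e \<in> E. internally_inactive V E \<epsilon> r f e}"
    have sub: "?I \<subseteq> E - {e0}"
      using least_active by auto
    have "card (E - {e0}) = n - 1"
      using e0 assms(4) by simp
    then have "card ?I = n - 1 \<longleftrightarrow> ?I = E - {e0}"
      using sub fin by (metis card_subset_eq finite_Diff)
    then show ?thesis
      using sub unfolding internal_inactivity_def by blast
  qed
  have "f = g e0" if f: "hypertree V E \<epsilon> f" "internal_inactivity V E \<epsilon> r f = n - 1" for f
  proof -
    have pos: "f e \<ge> 1" if "e \<in> E - {e0}" for e
      using f(2) that unfolding inactive by (auto simp: internally_inactive_def can_transfer_def)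
    \<comment> \<open>Measure the excess of \<open>f\<close> over 1 away from \<open>e0\<close>. As
      \<open>f\<close> sums to \<open>n - 1\<close>, the \<open>n - 1\<close> ones use up the total,
      forcing both the excess and \<open>f e0\<close> to vanish.\<close>
    have "(\<Sum>e\<in>E - {e0}. f e - 1) + (n - 1) = sum f (E - {e0})"
    proof -
      have "(\<Sum>e\<in>E - {e0}. f e - 1) + (n - 1) = (\<Sum>e\<in>E - {e0}. (f e - 1) + 1)"
        using e0 assms(4) by (simp only: sum.distrib) simp
      also have "\<dots> = sum f (E - {e0})"
        by (rule sum.cong) (use pos in \<open>auto simp: Suc_le_eq\<close>)
      finally show ?thesis .
    qed
    moreover have "sum f E = f e0 + sum f (E - {e0})"
      using e0 fin by (simp add: sum.remove)
    moreover have "sum f E + 1 = n"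
      using hypertree_sum[OF assms(1) f(1)] assms(3) by simp
    ultimately have "f e0 = 0" "(\<Sum>e\<in>E - {e0}. f e - 1) = 0"
      by linarith+
    then have "f e = (if e = e0 then 0 else 1)" if "e \<in> E" for e
      using pos[of e] that fin by (cases "e = e0") (auto simp: le_antisym)
    then show ?thesis
      using f(1) by (auto simp: hypertree_def g_def PiE_def extensional_def fun_eq_iff)
  qed
  moreover have "internal_inactivity V E \<epsilon> r (g e0) = n - 1"
    unfolding inactive
  proof
    fix e assume e: "e \<in> E - {e0}"
    \<comment> \<open>Moving one unit from \<open>e\<close> to \<open>e0\<close> turns
      \<open>g e0\<close> into the hypertree \<open>g e\<close>, so every other hyperedge can
      transfer to the least one.\<close>
    have "(g e0)(e := g e0 e - 1, e0 := g e0 e0 + 1) = g e"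
      using e e0 by (auto simp: g_def fun_eq_iff)
    then have "can_transfer V E \<epsilon> (g e0) e e0"
      using e e0 hyp[of e] by (auto simp: can_transfer_def g_def)
    then show "internally_inactive V E \<epsilon> r (g e0) e"
      using e e0 by (auto simp: internally_inactive_def)
  qed
  ultimately have only: "{f. hypertree V E \<epsilon> f} \<inter> {f. internal_inactivity V E \<epsilon> r f = n - 1} = {g e0}"
    using hyp e0 by auto
  \<comment> \<open>Each hypertree contributes one monomial, so the coefficient counts the
    hypertrees of inactivity \<open>n - 1\<close>.\<close>
  have "coeff (interior_polynomial V E \<epsilon> r) (n - 1)
      = (\<Sum>f | hypertree V E \<epsilon> f. if internal_inactivity V E \<epsilon> r f = n - 1 then 1 else 0)"
    by (simp add: interior_polynomial_def coeff_sum)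
  also have "\<dots> = int (card ({f. hypertree V E \<epsilon> f} \<inter> {f. internal_inactivity V E \<epsilon> r f = n - 1}))"
    using finite_hypertrees[OF assms(1)] by (simp add: sum.If_cases)
  also have "\<dots> = 1"
    unfolding only by simp
  finally show ?thesis .
qed

end
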